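(* Let $r\ge 1$ be an integer, let $\eta_0,u_0\in L^2(a,b)$, let $T>0$, and let $\tilde\eta:[0,T]\to\mathcal{P}^r$ and $\tilde u:[0,T]\to\mathcal{P}^r_0$ (continuously differentiable in $t$) be a solution of the semidiscrete system: for all $t\in[0,T]$, $$ \begin{aligned} (\tilde\eta_t,\chi)+\tfrac{1}{6}\big((P^r_0[\tilde\eta_x])_t,\chi_x\big)&=\big(P^r_0[(1+\tilde\eta)\tilde u],\chi_x\big) &&\text{for all }\chi\in\mathcal{P}^r,\\ (\tilde u_t,\psi)+\tfrac{1}{6}\big((P^r[\tilde u_x])_t,\psi_x\big)&=\tfrac{1}{2}\big(P^r[\tilde u^2],\psi_x\big)+\big(P^r[\tilde\eta],\psi_x\big) &&\text{for all }\psi\in\mathcal{P}^r_0, \end{aligned} $$ with initial conditions $\tilde\eta(\cdot,0)=P^r[\eta_0]$ and $\tilde u(\cdot,0)=P^r_0[u_0]$. Then for all $t\in[0,T]$: (i) (conservation of mass) $\displaystyle\frac{\mathrm{d}}{\mathrm{d}t}\mathcal{M}(t;\tilde\eta)=0$; (ii) (conservation of energy) $\displaystyle\frac{\mathrm{d}}{\mathrm{d}t}\mathcal{E}(t;\tilde\eta,\tilde u)=0$.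
   Context: Let $a<b$ be real numbers and let $a=x_0<x_1<\cdots<x_N=b$ be a uniform partition of $[a,b]$. For an integer $r\ge1$, let $\mathbb{P}^r$ be the space of polynomials of degree at most $r$, and define the Lagrange finite element spaces $$\mathcal{P}^r:=\{\phi\in C([a,b]):\ \phi|_{[x_j,x_{j+1}]}\in\mathbb{P}^r,\ 0\le j\le N-1\},\qquad \mathcal{P}^r_0:=\{\phi\in\mathcal{P}^r:\ \phi(a)=\phi(b)=0\}.$$ Let $(u,v):=\int_a^b uv\,\mathrm{d}x$ denote the $L^2(a,b)$ inner product. $P^r:L^2(a,b)\to\mathcal{P}^r$ and $P^r_0:L^2(a,b)\to\mathcal{P}^r_0$ denote the $L^2$-orthogonal projections, i.e. $(P^r[u],\phi)=(u,\phi)$ for all $\phi\in\mathcal{P}^r$ and $(P^r_0[u],\phi)=(u,\phi)$ for all $\phi\in\mathcal{P}^r_0$. Subscripts $x$ and $t$ denote derivatives in $x$ (weak, i.e. piecewise on the partition, for finite element functions) and in $t$. The mass and energy functionals (nondimensional form) are $$\mathcal{M}(t;\eta):=\int_a^b\eta(x,t)\,\mathrm{d}x,\qquad \mathcal{E}(t;\eta,u):=\frac12\int_a^b\Big(\eta(x,t)^2+(1+\eta(x,t))\,u(x,t)^2\Big)\mathrm{d}x.$$ The system is a semidiscretisation of the regularised shallow water (BBM-BBM) system $\eta_t+[(1+\eta)u]_x-\frac16\eta_{xxt}=0$, $u_t+\eta_x+uu_x-\frac16u_{xxt}=0$ on $[a,b]$ with reflective boundary conditions $\eta_x=u=0$ at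 $x=a,b$ and initial data $\eta_0,u_0$. *)

theory Defs
  imports "HOL-Analysis.Analysis" "HOL-Computational_Algebra.Polynomial"
begin

definition node :: "real \<Rightarrow> real \<Rightarrow> nat \<Rightarrow> nat \<Rightarrow> real" where
  "node a b N j = a + real j * (b - a) / real N"

(* A function on [a,b] is represented by its extension by zero to the real line. This makes
   equality of finite element functions equality of HOL functions, so that the
   L2-orthogonal projections below are uniquely determined. *)
definition lagrange_space :: "real \<Rightarrow> real \<Rightarrow> nat \<Rightarrow> nat \<Rightarrow> (real \<Rightarrow> real) set" where
  "lagrange_space a b N r = {\<phi>. continuous_on {a..b} \<phi>
     \<and> (\<forall>j<N. \<exists>p :: real poly. degree p \<le> r
            \<and> (\<forall>x\<in>{node a b N j..node a b N (Suc j)}. \<phi> x = poly p x))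
     \<and> (\<forall>x. x \<notin> {a..b} \<longrightarrow> \<phi> x = 0)}"

definition lagrange_space0 :: "real \<Rightarrow> real \<Rightarrow> nat \<Rightarrow> nat \<Rightarrow> (real \<Rightarrow> real) set" where
  "lagrange_space0 a b N r = {\<phi> \<in> lagrange_space a b N r. \<phi> a = 0 \<and> \<phi> b = 0}"

definition L2_space :: "real \<Rightarrow> real \<Rightarrow> (real \<Rightarrow> real) set" where
  "L2_space a b = {u. u \<in> borel_measurable (lebesgue_on {a..b})
     \<and> integrable (lebesgue_on {a..b}) (\<lambda>x. (u x)\<^sup>2)}"

definition L2_inner :: "real \<Rightarrow> real \<Rightarrow> (real \<Rightarrow> real) \<Rightarrow> (real \<Rightarrow> real) \<Rightarrow> real" where
  "L2_inner a b u v = (\<integral>x. u x * v x \<partial>lebesgue_on {a..b})"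

definition L2_proj ::
  "real \<Rightarrow> real \<Rightarrow> (real \<Rightarrow> real) set \<Rightarrow> (real \<Rightarrow> real) \<Rightarrow> real \<Rightarrow> real" where
  "L2_proj a b V u = (THE w. w \<in> V \<and> (\<forall>\<phi>\<in>V. L2_inner a b w \<phi> = L2_inner a b u \<phi>))"

(* Weak derivative in x of a finite element function: the classical derivative inside each
   element. The value 0 chosen at the nodes is immaterial, since these form a null set. *)
definition x_deriv :: "real \<Rightarrow> real \<Rightarrow> nat \<Rightarrow> (real \<Rightarrow> real) \<Rightarrow> real \<Rightarrow> real" where
  "x_deriv a b N \<phi> x =
     (if \<exists>j<N. node a b N j < x \<and> x < node a b N (Suc j) then deriv \<phi> x else 0)"

(* A function of (x,t) is a curve t \<mapsto> f t of functions of x.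
   The derivative in t is one-sided at t = 0 and t = T. *)
definition t_deriv :: "real \<Rightarrow> (real \<Rightarrow> real \<Rightarrow> real) \<Rightarrow> real \<Rightarrow> real \<Rightarrow> real" where
  "t_deriv T f t x = vector_derivative (\<lambda>s. f s x) (at t within {0..T})"

(* For curves in a finite-dimensional space of functions, as used here, continuous
   differentiability at each fixed x is the same as in any norm of that space. *)
definition C1_curve :: "real \<Rightarrow> (real \<Rightarrow> real) set \<Rightarrow> (real \<Rightarrow> real \<Rightarrow> real) \<Rightarrow> bool" where
  "C1_curve T V f \<longleftrightarrow> (\<forall>t\<in>{0..T}. f t \<in> V)
     \<and> (\<forall>x. (\<lambda>t. f t x) differentiable_on {0..T} \<and> continuous_on {0..T} (\<lambda>t. t_deriv T f t x))"

definition mass :: "real \<Rightarrow> real \<Rightarrow> (real \<Rightarrow> real \<Rightarrow> real) \<Rightarrow> real \<Rightarrow> real" where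
  "mass a b \<eta> t = (\<integral>x. \<eta> t x \<partial>lebesgue_on {a..b})"

definition energy ::
  "real \<Rightarrow> real \<Rightarrow> (real \<Rightarrow> real \<Rightarrow> real) \<Rightarrow> (real \<Rightarrow> real \<Rightarrow> real) \<Rightarrow> real \<Rightarrow> real" where
  "energy a b \<eta> u t =
     1/2 * (\<integral>x. (\<eta> t x)\<^sup>2 + (1 + \<eta> t x) * (u t x)\<^sup>2 \<partial>lebesgue_on {a..b})"

end

theory Submission imports Defs begin

text \<open>
  Put \<open>F = \<eta> + P[u\<^sup>2]/2\<close>, \<open>G = P\<^sub>0[(1 + \<eta>)u]\<close>, \<open>A = P[u\<^sub>t\<^sub>x]\<close>, \<open>B = P\<^sub>0[\<eta>\<^sub>t\<^sub>x]\<close> and \<open>Z = F - A/6\<close>,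
  \<open>W = G - B/6\<close>. The system reads \<open>(\<eta>\<^sub>t, \<chi>) = (W, \<chi>\<^sub>x)\<close> and \<open>(u\<^sub>t, \<psi>) = (Z, \<psi>\<^sub>x)\<close>, so \<open>\<chi> = 1\<close> gives
  conservation of mass. The energy has derivative \<open>(\<eta>\<^sub>t, F) + (u\<^sub>t, G)\<close>; testing with \<open>F = Z + A/6\<close>
  and \<open>G = W + B/6\<close> turns this into \<open>(W, Z\<^sub>x) + (Z, W\<^sub>x) + ((W, A\<^sub>x) + (Z, B\<^sub>x))/6\<close>, and testing with
  \<open>A\<close> and \<open>B\<close> turns the last bracket into \<open>(\<eta>\<^sub>t, u\<^sub>t\<^sub>x) + (u\<^sub>t, \<eta>\<^sub>t\<^sub>x)\<close>. Both pairs vanish on integrating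
  by parts, as \<open>W\<close> and \<open>u\<^sub>t\<close> are zero at the end points.

  Point evaluations at finitely many points are coordinates on the finite element space. Hence
  pointwise differentiability in time suffices to commute the time derivative with projections,
  space derivatives and integrals.
\<close>

section \<open>Function spaces whose elements are fixed by finitely many point values\<close>

definition fun_subspace :: "('a \<Rightarrow> real) set \<Rightarrow> bool" where
  "fun_subspace W \<longleftrightarrow> (\<lambda>_. 0) \<in> W \<and> (\<forall>f\<in>W. \<forall>g\<in>W. \<forall>c. (\<lambda>x. f x + c * g x) \<in> W)"

text \<open>On a subspace this says that evaluation at the points of \<open>X\<close> is injective.
  With \<open>X\<close> finite it expresses finite dimension in a form suited to induction on
  \<open>X\<close>.\<close>

definition determined_by :: "('a \<Rightarrow> real) set \<Rightarrow> 'a set \<Rightarrow> bool" where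
  "determined_by W X \<longleftrightarrow> (\<forall>f\<in>W. (\<forall>x\<in>X. f x = 0) \<longrightarrow> f = (\<lambda>_. 0))"

lemma fun_subspace_zero: "fun_subspace W \<Longrightarrow> (\<lambda>_. 0) \<in> W"
  by (simp add: fun_subspace_def)

lemma fun_subspace_add_scaled:
  "fun_subspace W \<Longrightarrow> f \<in> W \<Longrightarrow> g \<in> W \<Longrightarrow> (\<lambda>x. f x + c * g x) \<in> W"
  by (simp add: fun_subspace_def)

lemma fun_subspace_scale:
  assumes "fun_subspace W" "f \<in> W"
  shows "(\<lambda>x. c * f x) \<in> W"
  using fun_subspace_add_scaled[OF assms(1) fun_subspace_zero[OF assms(1)] assms(2)] by simp

lemma fun_subspace_sum:
  assumes "fun_subspace W" "\<And>y. y \<in> Y \<Longrightarrow> g y \<in> W"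
  shows "(\<lambda>x. \<Sum>y\<in>Y. c y * g y x) \<in> W"
proof (cases "finite Y")
  case True
  then show ?thesis using assms(2)
  proof (induction Y rule: finite_induct)
    case empty
    then show ?case using fun_subspace_zero[OF assms(1)] by simp
  next
    case (insert y Y)
    then have "(\<lambda>x. (\<Sum>y\<in>Y. c y * g y x) + c y * g y x) \<in> W"
      by (intro fun_subspace_add_scaled assms(1)) auto
    with insert show ?case by (simp add: add.commute)
  qed
qed (simp add: fun_subspace_zero assms(1))

lemma fun_subspace_vanishing:
  "fun_subspace W \<Longrightarrow> fun_subspace {f \<in> W. f x = 0}"
  by (auto simp: fun_subspace_def)

lemma determined_by_vanishing:
  "determined_by W (insert x X) \<Longrightarrow> determined_by {f \<in> W. f x = 0} X"
  by (auto simp: determined_by_def)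

lemma nonvanishing_normalised:
  assumes "fun_subspace W" "{f \<in> W. f x = 0} \<noteq> W"
  obtains f where "f \<in> W" "f x = 1"
proof -
  from assms(2) obtain g where g: "g \<in> W" "g x \<noteq> 0" by auto
  then have "(\<lambda>y. inverse (g x) * g y) \<in> W" by (intro fun_subspace_scale assms(1))
  then show ?thesis using g by (intro that[of "\<lambda>y. inverse (g x) * g y"]) auto
qed

text \<open>Induction on \<open>X\<close>: the functions of \<open>W\<close> that vanish at a point
  \<open>x\<close> form a subspace determined by the remaining points, and at most one more
  function, normalised at \<open>x\<close>, is needed to span \<open>W\<close>. The coefficients are
  values of \<open>f\<close> itself, so regularity in time at each fixed point becomes regularity of
  coordinates.\<close>

lemma pointwise_basis_exists:
  assumes "finite X" "fun_subspace W" "determined_by W X"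
  shows "\<exists>Y e. finite Y \<and> (\<forall>y\<in>Y. e y \<in> W) \<and> (\<forall>f\<in>W. f = (\<lambda>x. \<Sum>y\<in>Y. f y * e y x))"
  using assms
proof (induction X arbitrary: W rule: finite_induct)
  case empty
  then show ?case
    by (intro exI[of _ "{}"]) (auto simp: determined_by_def)
next
  case (insert x X)
  define W' where "W' = {f \<in> W. f x = 0}"
  obtain Y e where Y: "finite Y" "\<And>y. y \<in> Y \<Longrightarrow> e y \<in> W'"
    and rep: "\<And>f. f \<in> W' \<Longrightarrow> f = (\<lambda>z. \<Sum>y\<in>Y. f y * e y z)"
    using insert.IH[OF fun_subspace_vanishing determined_by_vanishing, of W x] insert.prems
    unfolding W'_def by blast
  show ?case
  proof (cases "W' = W")
    case True
    with Y rep show ?thesis by blast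
  next
    case False
    then obtain f where f: "f \<in> W" "f x = 1"
      using nonvanishing_normalised[OF insert.prems(1)] unfolding W'_def by blast
    define Z where "Z = Y - {x}"
    have rep': "g = (\<lambda>z. \<Sum>y\<in>Z. g y * e y z)" if "g \<in> W'" for g
    proof
      fix z
      have "g x = 0" using that by (simp add: W'_def)
      then have "(\<Sum>y\<in>Y. g y * e y z) = (\<Sum>y\<in>Z. g y * e y z)"
        unfolding Z_def by (intro sum.mono_neutral_right Y(1)) auto
      with fun_cong[OF rep[OF that], of z] show "g z = (\<Sum>y\<in>Z. g y * e y z)" by simp
    qed
    \<comment> \<open>Subtracting \<open>g x * f\<close> from \<open>g\<close> gives an element of
      \<open>W'\<close> with values \<open>g y - g x * f y\<close>. Using \<open>k\<close> in place
      of \<open>f\<close> absorbs the extra terms, so the coefficients become plain values of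
      \<open>g\<close>.\<close>
    define k where "k = (\<lambda>z. f z + (- 1) * (\<Sum>y\<in>Z. f y * e y z))"
    have "k \<in> W" unfolding k_def
      using Y(2) by (intro fun_subspace_add_scaled fun_subspace_sum insert.prems(1) f(1))
        (auto simp: Z_def W'_def)
    moreover have "g = (\<lambda>z. \<Sum>y\<in>insert x Z. g y * (e(x := k)) y z)" if g: "g \<in> W" for g
    proof
      fix z
      let ?g' = "\<lambda>z. g z + (- g x) * f z"
      have "?g' \<in> W" by (intro fun_subspace_add_scaled insert.prems(1) f(1) g)
      then have "?g' \<in> W'" using f(2) by (simp add: W'_def)
      from fun_cong[OF rep'[OF this], of z]
      have "g z = g x * f z + (\<Sum>y\<in>Z. (g y - g x * f y) * e y z)" by simp
      also have "\<dots> = g x * k z + (\<Sum>y\<in>Z. g y * e y z)"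
        by (simp add: k_def algebra_simps sum_subtractf sum_distrib_left sum_negf)
      also have "(\<Sum>y\<in>Z. g y * e y z) = (\<Sum>y\<in>Z. g y * (e(x := k)) y z)"
        by (intro sum.cong) (auto simp: Z_def)
      finally have "g z = g x * k z + (\<Sum>y\<in>Z. g y * (e(x := k)) y z)" .
      moreover have "finite Z" "x \<notin> Z" using Y(1) by (auto simp: Z_def)
      ultimately show "g z = (\<Sum>y\<in>insert x Z. g y * (e(x := k)) y z)" by simp
    qed
    ultimately show ?thesis using Y
      by (intro exI[of _ "insert x Z"] exI[of _ "e(x := k)"]) (auto simp: Z_def W'_def)
  qed
qed

text \<open>The representer is built one dimension at a time: a representer on the functions
  vanishing at \<open>x\<close> is corrected along a vector orthogonal to all of them. Definiteness
  makes the normalising denominator nonzero.\<close>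

lemma riesz_representation:
  fixes B :: "('a \<Rightarrow> real) \<Rightarrow> ('a \<Rightarrow> real) \<Rightarrow> real"
  assumes "finite X" "fun_subspace W" "determined_by W X"
    and lin: "\<And>f g h c. f \<in> W \<Longrightarrow> g \<in> W \<Longrightarrow> h \<in> W \<Longrightarrow>
      B (\<lambda>x. f x + c * g x) h = B f h + c * B g h"
    and sym: "\<And>f g. f \<in> W \<Longrightarrow> g \<in> W \<Longrightarrow> B f g = B g f"
    and def: "\<And>f. f \<in> W \<Longrightarrow> B f f = 0 \<Longrightarrow> f = (\<lambda>_. 0)"
    and L: "\<And>f g c. f \<in> W \<Longrightarrow> g \<in> W \<Longrightarrow> L (\<lambda>x. f x + c * g x) = L f + c * L g"
  shows "\<exists>w\<in>W. \<forall>f\<in>W. B w f = (L f :: real)"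
  using assms
proof (induction X arbitrary: W L rule: finite_induct)
  case empty
  then have W: "f = (\<lambda>_. 0)" if "f \<in> W" for f using that by (simp add: determined_by_def)
  have 0: "(\<lambda>_. 0) \<in> W" using empty by (simp add: fun_subspace_def)
  have "L (\<lambda>_. 0) = 0" using empty(6)[OF 0 0, of 1] by simp
  moreover have "B (\<lambda>_. 0) (\<lambda>_. 0) = 0" using empty(3)[OF 0 0 0, of 1] by simp
  ultimately show ?case using W 0 by metis
next
  case (insert x X)
  define W' where "W' = {f \<in> W. f x = 0}"
  have sub: "f \<in> W" "f x = 0" if "f \<in> W'" for f using that by (auto simp: W'_def)
  have W': "fun_subspace W'" "determined_by W' X"
    unfolding W'_def
    by (rule fun_subspace_vanishing[OF insert.prems(1)], rule determined_by_vanishing[OF insert.prems(2)])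
  note lin = insert.prems(3) and sym = insert.prems(4) and def = insert.prems(5)
    and L = insert.prems(6)
  have lin_right: "B h (\<lambda>x. f x + c * g x) = B h f + c * B h g"
    if "f \<in> W" "g \<in> W" "h \<in> W" for f g h c
  proof -
    have "B h (\<lambda>x. f x + c * g x) = B (\<lambda>x. f x + c * g x) h"
      by (intro sym fun_subspace_add_scaled insert.prems(1) that)
    also have "\<dots> = B f h + c * B g h" by (rule lin[OF that])
    also have "B f h = B h f" by (rule sym[OF that(1,3)])
    also have "B g h = B h g" by (rule sym[OF that(2,3)])
    finally show ?thesis .
  qed
  \<comment> \<open>The functional is kept general because two are needed: \<open>L\<close> itself,
    and \<open>B f\<close>, whose representer is the orthogonal projection of \<open>f\<close> onto
    \<open>W'\<close>.\<close>
  have IH: "\<exists>w\<in>W'. \<forall>f\<in>W'. B w f = M f"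
    if "\<And>f g c. f \<in> W \<Longrightarrow> g \<in> W \<Longrightarrow> M (\<lambda>x. f x + c * g x) = M f + c * M g" for M
  proof (rule insert.IH[where L = M, OF W'])
    fix f g h c assume fgh: "f \<in> W'" "g \<in> W'" "h \<in> W'"
    show "B (\<lambda>x. f x + c * g x) h = B f h + c * B g h"
      by (rule lin[OF fgh[THEN sub(1)]])
  next
    fix f g c assume fg: "f \<in> W'" "g \<in> W'"
    show "B f g = B g f" by (rule sym[OF fg[THEN sub(1)]])
    show "M (\<lambda>x. f x + c * g x) = M f + c * M g" by (rule that[OF fg[THEN sub(1)]])
  next
    fix f assume "f \<in> W'" "B f f = 0"
    then show "f = (\<lambda>_. 0)" by (intro def sub(1))
  qed
  have IHL: "\<exists>w\<in>W'. \<forall>f\<in>W'. B w f = L f" by (rule IH) (rule L)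
  show ?case
  proof (cases "W' = W")
    case True
    then show ?thesis using IHL by simp
  next
    case False
    then obtain f where f: "f \<in> W" "f x = 1"
      using nonvanishing_normalised[OF insert.prems(1)] unfolding W'_def by blast
    obtain p where p: "p \<in> W'" "\<And>g. g \<in> W' \<Longrightarrow> B p g = B f g"
      using IH[of "B f", OF lin_right[OF _ _ f(1)]] by blast
    define k where "k = (\<lambda>z. f z + (- 1) * p z)"
    have k: "k \<in> W"
      unfolding k_def by (intro fun_subspace_add_scaled insert.prems(1) f(1) sub(1)[OF p(1)])
    have kx: "k x = 1" using f(2) sub(2)[OF p(1)] by (simp add: k_def)
    have orth: "B k g = 0" if "g \<in> W'" for g
      using lin[OF f(1) sub(1)[OF p(1)] sub(1)[OF that], of "- 1"] p(2)[OF that] by (simp add: k_def)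
    have kk: "B k k \<noteq> 0" using def[OF k] kx by (metis zero_neq_one)
    obtain w where w: "w \<in> W'" "\<And>g. g \<in> W' \<Longrightarrow> B w g = L g" using IHL by blast
    \<comment> \<open>Since \<open>k\<close> is orthogonal to \<open>W'\<close>, adding a multiple
      of it leaves the pairing with \<open>W'\<close> unchanged; the factor is the one that gives
      \<open>B v k = L k\<close>. Every \<open>g\<close> in \<open>W\<close> splits into an element
      of \<open>W'\<close> and \<open>g x * k\<close>.\<close>
    define v where "v = (\<lambda>z. w z + (L k / B k k) * k z)"
    have v: "v \<in> W"
      unfolding v_def by (intro fun_subspace_add_scaled insert.prems(1) k sub(1)[OF w(1)])
    have "B v g = L g" if g: "g \<in> W" for g
    proof -
      define g' where "g' = (\<lambda>z. g z + (- g x) * k z)"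
      have "g' \<in> W" unfolding g'_def by (intro fun_subspace_add_scaled insert.prems(1) k g)
      then have g': "g' \<in> W'" using kx by (simp add: W'_def g'_def)
      have dec: "(\<lambda>z. g' z + g x * k z) = g" by (simp add: g'_def)
      have "B v g' = L g'" using lin[OF sub(1)[OF w(1)] k sub(1)[OF g'], of "L k / B k k"] orth[OF g'] w(2)[OF g']
        by (simp add: v_def)
      moreover have "B v k = L k"
        using lin[OF sub(1)[OF w(1)] k k, of "L k / B k k"] orth[OF w(1)] sym[OF k sub(1)[OF w(1)]] kk
        by (simp add: v_def)
      moreover have "B v g = B v g' + g x * B v k"
        using lin_right[OF sub(1)[OF g'] k v, of "g x"] unfolding dec .
      moreover have "L g = L g' + g x * L k"
        using L[OF sub(1)[OF g'] k, of "g x"] unfolding dec .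
      ultimately show ?thesis by simp
    qed
    with v show ?thesis by blast
  qed
qed

section \<open>Bounded measurable functions and bilinearity of the L2 inner product\<close>

text \<open>A class closed under sums and products that contains the finite element functions and
  also their weak derivatives, which may jump at the nodes. On it all integrals exist, and the
  Lebesgue and gauge integrals over the interval agree.\<close>

definition bounded_measurable :: "real \<Rightarrow> real \<Rightarrow> (real \<Rightarrow> real) set" where
  "bounded_measurable a b =
     {f \<in> borel_measurable (lebesgue_on {a..b}). \<exists>C. \<forall>x\<in>{a..b}. \<bar>f x\<bar> \<le> C}"

lemma continuous_bounded_measurable:
  assumes "continuous_on {a..b} f"
  shows "f \<in> bounded_measurable a b"
proof -
  have "bounded (f ` {a..b})"
    by (intro compact_imp_bounded compact_continuous_image assms) simp
  then show ?thesis
    using continuous_imp_measurable_on_sets_lebesgue[OF assms]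
    by (auto simp: bounded_measurable_def bounded_iff)
qed

lemma bounded_measurable_add:
  assumes "f \<in> bounded_measurable a b" "g \<in> bounded_measurable a b"
  shows "(\<lambda>x. f x + g x) \<in> bounded_measurable a b"
proof -
  obtain C D where "\<forall>x\<in>{a..b}. \<bar>f x\<bar> \<le> C" "\<forall>x\<in>{a..b}. \<bar>g x\<bar> \<le> D"
    using assms by (auto simp: bounded_measurable_def)
  then have "\<forall>x\<in>{a..b}. \<bar>f x + g x\<bar> \<le> C + D" by (metis abs_triangle_ineq add_mono order_trans)
  with assms show ?thesis unfolding bounded_measurable_def by auto
qed

lemma bounded_measurable_mult:
  assumes "f \<in> bounded_measurable a b" "g \<in> bounded_measurable a b"
  shows "(\<lambda>x. f x * g x) \<in> bounded_measurable a b"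
proof -
  obtain C D where "\<forall>x\<in>{a..b}. \<bar>f x\<bar> \<le> C" "\<forall>x\<in>{a..b}. \<bar>g x\<bar> \<le> D"
    using assms by (auto simp: bounded_measurable_def)
  then have "\<forall>x\<in>{a..b}. \<bar>f x * g x\<bar> \<le> C * D"
    by (metis abs_ge_zero abs_mult mult_mono order_trans)
  with assms show ?thesis unfolding bounded_measurable_def by auto
qed

lemma bounded_measurable_scale:
  "f \<in> bounded_measurable a b \<Longrightarrow> (\<lambda>x. c * f x) \<in> bounded_measurable a b"
  by (rule bounded_measurable_mult[OF continuous_bounded_measurable]) auto

lemma bounded_measurable_sum:
  "(\<And>y. y \<in> Y \<Longrightarrow> g y \<in> bounded_measurable a b) \<Longrightarrow>
    (\<lambda>x. \<Sum>y\<in>Y. g y x) \<in> bounded_measurable a b"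
  by (induction Y rule: infinite_finite_induct)
    (auto intro: bounded_measurable_add continuous_bounded_measurable)

lemma bounded_measurable_integrable:
  assumes "f \<in> bounded_measurable a b"
  shows "integrable (lebesgue_on {a..b}) f"
proof -
  interpret finite_measure "lebesgue_on {a..b}" by (rule finite_measure_lebesgue_on) auto
  obtain C where "\<forall>x\<in>{a..b}. \<bar>f x\<bar> \<le> C" using assms by (auto simp: bounded_measurable_def)
  then show ?thesis using assms
    by (intro integrable_const_bound[where B = C]) (auto simp: bounded_measurable_def)
qed

lemma bounded_measurable_integral:
  "f \<in> bounded_measurable a b \<Longrightarrow> (\<integral>x. f x \<partial>lebesgue_on {a..b}) = integral {a..b} f"
  by (intro lebesgue_integral_eq_integral bounded_measurable_integrable) auto

lemma bounded_measurable_integrable_on: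
  "f \<in> bounded_measurable a b \<Longrightarrow> f integrable_on {a..b}"
  using bounded_measurable_integrable by (intro integrable_on_lebesgue_on) auto

lemma L2_inner_sym: "L2_inner a b f g = L2_inner a b g f"
  by (simp add: L2_inner_def mult.commute)

lemma L2_inner_add_scaled:
  assumes "f \<in> bounded_measurable a b" "g \<in> bounded_measurable a b" "h \<in> bounded_measurable a b"
  shows "L2_inner a b (\<lambda>x. f x + c * g x) h = L2_inner a b f h + c * L2_inner a b g h"
proof -
  have "L2_inner a b (\<lambda>x. f x + c * g x) h = (\<integral>x. f x * h x + c * (g x * h x) \<partial>lebesgue_on {a..b})"
    unfolding L2_inner_def by (intro Bochner_Integration.integral_cong) (auto simp: algebra_simps)
  also have "\<dots> = L2_inner a b f h + c * L2_inner a b g h"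
    unfolding L2_inner_def using assms
    by (subst Bochner_Integration.integral_add)
      (auto intro!: bounded_measurable_integrable bounded_measurable_mult)
  finally show ?thesis .
qed

lemma L2_inner_add_scaled_right:
  assumes "f \<in> bounded_measurable a b" "g \<in> bounded_measurable a b" "h \<in> bounded_measurable a b"
  shows "L2_inner a b h (\<lambda>x. f x + c * g x) = L2_inner a b h f + c * L2_inner a b h g"
  using L2_inner_add_scaled[OF assms] by (simp add: L2_inner_sym)

lemma L2_inner_sum:
  assumes "\<And>y. y \<in> Y \<Longrightarrow> g y \<in> bounded_measurable a b" "h \<in> bounded_measurable a b"
  shows "L2_inner a b (\<lambda>x. \<Sum>y\<in>Y. c y * g y x) h = (\<Sum>y\<in>Y. c y * L2_inner a b (g y) h)"
proof -
  have "L2_inner a b (\<lambda>x. \<Sum>y\<in>Y. c y * g y x) h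
      = (\<integral>x. (\<Sum>y\<in>Y. c y * (g y x * h x)) \<partial>lebesgue_on {a..b})"
    unfolding L2_inner_def
    by (intro Bochner_Integration.integral_cong) (auto simp: sum_distrib_right mult.assoc)
  also have "\<dots> = (\<Sum>y\<in>Y. c y * L2_inner a b (g y) h)"
    unfolding L2_inner_def using assms
    by (subst Bochner_Integration.integral_sum)
      (auto intro!: bounded_measurable_integrable bounded_measurable_mult)
  finally show ?thesis .
qed

section \<open>The mesh and the finite element spaces\<close>

locale uniform_mesh =
  fixes a b :: real and N :: nat
  assumes a_less_b: "a < b" and N_pos: "N \<ge> 1"
begin

abbreviation V :: "nat \<Rightarrow> (real \<Rightarrow> real) set" where "V \<equiv> lagrange_space a b N"

abbreviation V0 :: "nat \<Rightarrow> (real \<Rightarrow> real) set" where "V0 \<equiv> lagrange_space0 a b N"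

abbreviation nodes :: "real set" where "nodes \<equiv> node a b N ` {..N}"

lemma node_0: "node a b N 0 = a"
  by (simp add: node_def)

lemma node_N: "node a b N N = b"
  using N_pos by (simp add: node_def)

lemma node_mono: "i \<le> j \<Longrightarrow> node a b N i \<le> node a b N j"
  using a_less_b N_pos by (auto simp: node_def intro!: divide_right_mono mult_right_mono)

lemma node_less_Suc: "node a b N j < node a b N (Suc j)"
  using a_less_b N_pos by (auto simp: node_def intro!: divide_strict_right_mono mult_strict_right_mono)

lemma element_subset:
  assumes "j < N"
  shows "{node a b N j..node a b N (Suc j)} \<subseteq> {a..b}"
  using node_mono[of 0 j] node_mono[of "Suc j" N] assms by (auto simp: node_0 node_N)

text \<open>Half-open elements do not overlap, so the induction is a case split at the last node but
  one.\<close>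

lemma left_open_elements_cover:
  "node a b N 0 < x \<Longrightarrow> x \<le> node a b N n \<Longrightarrow> \<exists>j<n. node a b N j < x \<and> x \<le> node a b N (Suc j)"
proof (induction n)
  case (Suc n)
  then show ?case by (cases "x \<le> node a b N n") (auto simp: less_Suc_eq)
qed simp

lemma elements_cover:
  assumes "x \<in> {a..b}"
  obtains j where "j < N" "x \<in> {node a b N j..node a b N (Suc j)}"
proof (cases "x = a")
  case True
  then show ?thesis using that[of 0] N_pos node_less_Suc[of 0] by (simp add: node_0)
next
  case False
  then obtain j where "j < N" "node a b N j < x" "x \<le> node a b N (Suc j)"
    using left_open_elements_cover[of x N] assms by (auto simp: node_0 node_N)
  then show ?thesis using that[of j] by simp
qed

lemma open_elements_cover:
  assumes "x \<in> {a..b} - nodes"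
  obtains j where "j < N" "node a b N j < x" "x < node a b N (Suc j)"
proof -
  obtain j where j: "j < N" "x \<in> {node a b N j..node a b N (Suc j)}"
    using elements_cover assms by blast
  then have "x \<noteq> node a b N j" "x \<noteq> node a b N (Suc j)" using assms by force+
  then show ?thesis using j that[of j] by simp
qed

lemma open_element_unique:
  assumes "node a b N i < x" "x < node a b N (Suc i)" "node a b N j < x" "x < node a b N (Suc j)"
  shows "i = j"
proof (rule ccontr)
  assume "i \<noteq> j"
  then have "Suc i \<le> j \<or> Suc j \<le> i" by auto
  then show False using assms node_mono[of "Suc i" j] node_mono[of "Suc j" i] by auto
qed

text \<open>The fixed value zero at the nodes and outside the interval lets linear identities for
  the weak derivative hold as equalities of functions, not merely almost everywhere.\<close>

lemma x_deriv_eq_0: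
  assumes "x \<notin> {a..b} - nodes"
  shows "x_deriv a b N \<phi> x = 0"
proof -
  have "\<not> (node a b N j < x \<and> x < node a b N (Suc j))" if j: "j < N" for j
  proof
    assume x: "node a b N j < x \<and> x < node a b N (Suc j)"
    then have "x \<in> {a..b}" using element_subset[OF j] by auto
    then obtain i where "x = node a b N i" using assms by auto
    then have "j < i" "i < Suc j" using x node_mono[of i j] node_mono[of "Suc j" i] by (auto simp: not_less[symmetric])
    then show False by simp
  qed
  then show ?thesis by (auto simp: x_deriv_def)
qed

lemma fun_subspace_lagrange: "fun_subspace (V r)"
proof -
  have "(\<lambda>x. f x + c * g x) \<in> V r" if f: "f \<in> V r" and g: "g \<in> V r" for f g c
  proof -
    have "\<exists>p. degree p \<le> r \<and> (\<forall>x\<in>{node a b N j..node a b N (Suc j)}. f x + c * g x = poly p x)"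
      if "j < N" for j
    proof -
      from f that obtain p where "degree p \<le> r"
        "\<forall>x\<in>{node a b N j..node a b N (Suc j)}. f x = poly p x"
        unfolding lagrange_space_def by blast
      moreover from g that obtain q where "degree q \<le> r"
        "\<forall>x\<in>{node a b N j..node a b N (Suc j)}. g x = poly q x"
        unfolding lagrange_space_def by blast
      ultimately show ?thesis
        by (intro exI[of _ "p + smult c q"]) (auto intro: degree_add_le order.trans[OF degree_smult_le])
    qed
    then show ?thesis using f g by (auto simp: lagrange_space_def intro!: continuous_intros)
  qed
  moreover have "(\<lambda>_. 0) \<in> V r"
    by (auto simp: lagrange_space_def intro!: exI[of _ 0])
  ultimately show ?thesis by (simp add: fun_subspace_def)
qed

lemma fun_subspace_lagrange0: "fun_subspace (V0 r)"
  using fun_subspace_lagrange[of r] by (auto simp: fun_subspace_def lagrange_space0_def)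

lemma lagrange0_subset: "V0 r \<subseteq> V r"
  by (auto simp: lagrange_space0_def)

text \<open>Each element contributes \<open>r + 1\<close> points, enough to determine a polynomial of degree
  at most \<open>r\<close>.\<close>

lemma lagrange_determined:
  obtains X where "finite X" "determined_by (V r) X"
proof -
  have "\<exists>B. finite B \<and> card B = Suc r \<and> B \<subseteq> {node a b N j..node a b N (Suc j)}" for j
    using infinite_arbitrarily_large[of "{node a b N j..node a b N (Suc j)}" "Suc r"] node_less_Suc[of j]
    by (auto simp: infinite_Icc)
  then obtain B where B: "\<And>j. finite (B j)" "\<And>j. card (B j) = Suc r"
      "\<And>j. B j \<subseteq> {node a b N j..node a b N (Suc j)}"
    by metis
  have "f = (\<lambda>_. 0)" if f: "f \<in> V r" and 0: "\<forall>x\<in>(\<Union>j<N. B j). f x = 0" for f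
  proof
    fix x
    show "f x = 0"
    proof (cases "x \<in> {a..b}")
      case True
      then obtain j where j: "j < N" "x \<in> {node a b N j..node a b N (Suc j)}"
        using elements_cover by blast
      obtain p where p: "degree p \<le> r" "\<And>x. x \<in> {node a b N j..node a b N (Suc j)} \<Longrightarrow> f x = poly p x"
        using f j(1) unfolding lagrange_space_def by blast
      have "p = 0"
      proof (rule ccontr)
        assume "p \<noteq> 0"
        have "B j \<subseteq> {x. poly p x = 0}" using 0 p(2) B(3)[of j] j(1) by force
        then have "Suc r \<le> card {x. poly p x = 0}"
          using card_mono[OF poly_roots_finite[OF \<open>p \<noteq> 0\<close>]] B(2) by metis
        also have "\<dots> \<le> degree p" by (rule card_poly_roots_bound[OF \<open>p \<noteq> 0\<close>])
        finally show False using p(1) by simp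
      qed
      then show ?thesis using p(2) j(2) by simp
    qed (use f in \<open>auto simp: lagrange_space_def\<close>)
  qed
  then show ?thesis using B(1) by (intro that[of "\<Union>j<N. B j"]) (auto simp: determined_by_def)
qed

section \<open>Weak derivatives and integration by parts\<close>

lemma fe_continuous: "\<phi> \<in> V r \<Longrightarrow> continuous_on {a..b} \<phi>"
  by (simp add: lagrange_space_def)

lemma fe_bounded_measurable: "\<phi> \<in> V r \<Longrightarrow> \<phi> \<in> bounded_measurable a b"
  by (intro continuous_bounded_measurable fe_continuous)

lemma fe_polys:
  assumes "\<phi> \<in> V r"
  obtains p where "\<And>j x. j < N \<Longrightarrow> x \<in> {node a b N j..node a b N (Suc j)} \<Longrightarrow> \<phi> x = poly (p j) x"
  using assms unfolding lagrange_space_def mem_Collect_eq by metis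

lemma poly_piece_deriv:
  assumes "\<And>x. x \<in> {l..h} \<Longrightarrow> \<phi> x = poly p x" "l < x" "x < h"
  shows "(\<phi> has_real_derivative poly (pderiv p) x) (at x)"
  using poly_DERIV[of p x]
proof (rule has_field_derivative_transform_within_open)
  show "open {l<..<h}" by simp
qed (use assms in auto)

lemma fe_deriv:
  assumes "\<phi> \<in> V r" "x \<in> {a..b} - nodes"
  shows "(\<phi> has_real_derivative x_deriv a b N \<phi> x) (at x)"
proof -
  obtain j where j: "j < N" "node a b N j < x" "x < node a b N (Suc j)"
    using open_elements_cover assms(2) by blast
  obtain p where p: "\<And>j x. j < N \<Longrightarrow> x \<in> {node a b N j..node a b N (Suc j)} \<Longrightarrow> \<phi> x = poly (p j) x"
    using fe_polys[OF assms(1)] by blast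
  have d: "(\<phi> has_real_derivative poly (pderiv (p j)) x) (at x)"
    using p[OF j(1)] j(2,3) by (rule poly_piece_deriv)
  have "x_deriv a b N \<phi> x = deriv \<phi> x" using j by (auto simp: x_deriv_def)
  then show ?thesis using d DERIV_imp_deriv by metis
qed

text \<open>The weak derivative is a finite sum of polynomials multiplied by indicators of the open
  elements, which are pairwise disjoint.\<close>

lemma x_deriv_bounded_measurable:
  assumes "\<phi> \<in> V r"
  shows "x_deriv a b N \<phi> \<in> bounded_measurable a b"
proof -
  obtain p where p: "\<And>j x. j < N \<Longrightarrow> x \<in> {node a b N j..node a b N (Suc j)} \<Longrightarrow> \<phi> x = poly (p j) x"
    using fe_polys[OF assms] by blast
  let ?I = "\<lambda>j. {node a b N j<..<node a b N (Suc j)}"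
  have eq: "x_deriv a b N \<phi> = (\<lambda>x. \<Sum>j<N. indicator (?I j) x * poly (pderiv (p j)) x)"
  proof
    fix x
    show "x_deriv a b N \<phi> x = (\<Sum>j<N. indicator (?I j) x * poly (pderiv (p j)) x)"
    proof (cases "\<exists>j<N. x \<in> ?I j")
      case True
      then obtain j where j: "j < N" "x \<in> ?I j" by blast
      have "(\<Sum>i<N. indicator (?I i) x * poly (pderiv (p i)) x)
          = (\<Sum>i\<in>{j}. indicator (?I i) x * poly (pderiv (p i)) x)"
        using j open_element_unique[of _ x j]
        by (intro sum.mono_neutral_right) (auto simp: indicator_def)
      also have "\<dots> = deriv \<phi> x"
        using DERIV_imp_deriv[OF poly_piece_deriv[OF p[OF j(1)]]] j by simp
      also have "\<dots> = x_deriv a b N \<phi> x" using j by (auto simp: x_deriv_def)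
      finally show ?thesis by simp
    next
      case False
      then have "x_deriv a b N \<phi> x = 0" by (auto simp: x_deriv_def)
      moreover have "(\<Sum>j<N. indicator (?I j) x * poly (pderiv (p j)) x) = 0"
        using False by (intro sum.neutral) auto
      ultimately show ?thesis by simp
    qed
  qed
  have ind: "indicator (?I j) \<in> bounded_measurable a b" for j
  proof -
    have "indicator (?I j) \<in> borel_measurable (lebesgue_on {a..b})"
      by (intro measurable_restrict_space1 borel_measurable_indicator) auto
    then show ?thesis
      unfolding bounded_measurable_def by (auto intro!: exI[of _ 1] simp: indicator_def)
  qed
  show ?thesis
    unfolding eq
    by (intro bounded_measurable_sum bounded_measurable_mult[OF ind] continuous_bounded_measurable
        continuous_intros)
qed

text \<open>Away from the nodes this is uniqueness of the classical derivative; everywhere else both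
  sides are zero by convention.\<close>

lemma x_deriv_sum:
  assumes "\<And>y. y \<in> Y \<Longrightarrow> g y \<in> V r"
  shows "x_deriv a b N (\<lambda>x. \<Sum>y\<in>Y. c y * g y x) = (\<lambda>x. \<Sum>y\<in>Y. c y * x_deriv a b N (g y) x)"
proof
  fix x
  show "x_deriv a b N (\<lambda>x. \<Sum>y\<in>Y. c y * g y x) x = (\<Sum>y\<in>Y. c y * x_deriv a b N (g y) x)"
  proof (cases "x \<in> {a..b} - nodes")
    case True
    have "((\<lambda>x. \<Sum>y\<in>Y. c y * g y x) has_real_derivative (\<Sum>y\<in>Y. c y * x_deriv a b N (g y) x)) (at x)"
      using fe_deriv[OF assms True] by (intro DERIV_sum DERIV_cmult)
    moreover have "((\<lambda>x. \<Sum>y\<in>Y. c y * g y x) has_real_derivative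
        x_deriv a b N (\<lambda>x. \<Sum>y\<in>Y. c y * g y x) x) (at x)"
      using assms True by (intro fe_deriv[where r = r] fun_subspace_sum fun_subspace_lagrange)
    ultimately show ?thesis by (metis DERIV_unique)
  qed (simp add: x_deriv_eq_0)
qed

lemma x_deriv_add_scaled:
  assumes "f \<in> V r" "g \<in> V r"
  shows "x_deriv a b N (\<lambda>x. f x + c * g x) = (\<lambda>x. x_deriv a b N f x + c * x_deriv a b N g x)"
proof -
  \<comment> \<open>The two terms are written as a sum indexed by truth values, so that the general
    linearity applies.\<close>
  have "x_deriv a b N (\<lambda>x. \<Sum>y\<in>{True, False}. (if y then 1 else c) * (if y then f else g) x)
      = (\<lambda>x. \<Sum>y\<in>{True, False}. (if y then 1 else c) * x_deriv a b N (if y then f else g) x)"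
    by (rule x_deriv_sum[where r = r]) (use assms in auto)
  then show ?thesis by simp
qed

text \<open>The product is continuous on the whole interval and differentiable off the finitely many
  nodes, so the fundamental theorem of calculus with a finite exceptional set leaves only boundary
  terms at \<open>a\<close> and \<open>b\<close>. They vanish with \<open>\<psi>\<close>.\<close>

lemma integration_by_parts_0:
  assumes "\<phi> \<in> V r" "\<psi> \<in> V0 r"
  shows "L2_inner a b (x_deriv a b N \<phi>) \<psi> + L2_inner a b \<phi> (x_deriv a b N \<psi>) = 0"
proof -
  have \<psi>: "\<psi> \<in> V r" "\<psi> a = 0" "\<psi> b = 0" using assms(2) by (auto simp: lagrange_space0_def)
  let ?h = "\<lambda>x. x_deriv a b N \<phi> x * \<psi> x + \<phi> x * x_deriv a b N \<psi> x"
  have "(?h has_integral (\<phi> b * \<psi> b - \<phi> a * \<psi> a)) {a..b}"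
  proof (rule fundamental_theorem_of_calculus_interior_strong[of nodes])
    show "continuous_on {a..b} (\<lambda>x. \<phi> x * \<psi> x)"
      using assms \<psi> by (intro continuous_intros fe_continuous)
    fix x assume "x \<in> {a<..<b} - nodes"
    then have x: "x \<in> {a..b} - nodes" by auto
    show "((\<lambda>x. \<phi> x * \<psi> x) has_vector_derivative ?h x) (at x)"
      using fe_deriv[OF assms(1) x] fe_deriv[OF \<psi>(1) x]
      unfolding has_real_derivative_iff_has_vector_derivative[symmetric]
      by (auto intro!: derivative_eq_intros)
  qed (use a_less_b in auto)
  then have "integral {a..b} ?h = 0" using \<psi> by (simp add: integral_unique)
  moreover have bm: "(\<lambda>x. x_deriv a b N \<phi> x * \<psi> x) \<in> bounded_measurable a b"
      "(\<lambda>x. \<phi> x * x_deriv a b N \<psi> x) \<in> bounded_measurable a b"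
    using assms(1) \<psi>(1)
    by (auto intro: bounded_measurable_mult x_deriv_bounded_measurable fe_bounded_measurable)
  ultimately have "(\<integral>x. ?h x \<partial>lebesgue_on {a..b}) = 0"
    by (subst bounded_measurable_integral) (auto intro: bounded_measurable_add)
  then show ?thesis
    unfolding L2_inner_def using bm
    by (subst (asm) Bochner_Integration.integral_add) (auto intro: bounded_measurable_integrable)
qed

section \<open>Definiteness and L2-orthogonal projections\<close>

text \<open>A continuous nonnegative function with zero integral vanishes on the interval. Outside
  it \<open>w\<close> is zero by the extension convention, so \<open>w\<close> is the zero function
  on the whole line.\<close>

lemma L2_inner_definite:
  assumes "w \<in> V r" "L2_inner a b w w = 0"
  shows "w = (\<lambda>_. 0)"
proof
  fix x
  have c: "continuous_on {a..b} (\<lambda>x. w x * w x)"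
    using assms(1) by (intro continuous_intros fe_continuous)
  have bm: "(\<lambda>x. w x * w x) \<in> bounded_measurable a b" by (rule continuous_bounded_measurable[OF c])
  have "((\<lambda>x. w x * w x) has_integral 0) {a..b}"
    using integrable_integral[OF bounded_measurable_integrable_on[OF bm]] assms(2)
      bounded_measurable_integral[OF bm] by (simp add: L2_inner_def)
  then have "w x * w x = 0" if "x \<in> {a..b}"
    using has_integral_0_cbox_imp_0[of a b "\<lambda>x. w x * w x" x] c that a_less_b by simp
  then show "w x = 0" using assms(1) by (cases "x \<in> {a..b}") (auto simp: lagrange_space_def)
qed

text \<open>Covers \<open>V r\<close> and \<open>V0 r\<close> together, so that projections and
  curves are treated once for both.\<close>

definition fe_subspace :: "nat \<Rightarrow> (real \<Rightarrow> real) set \<Rightarrow> bool" where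
  "fe_subspace r W \<longleftrightarrow> fun_subspace W \<and> W \<subseteq> V r"

lemma fe_subspace_lagrange: "fe_subspace r (V r)"
  by (simp add: fe_subspace_def fun_subspace_lagrange)

lemma fe_subspace_lagrange0: "fe_subspace r (V0 r)"
  by (simp add: fe_subspace_def fun_subspace_lagrange0 lagrange0_subset)

lemma fe_subspace_determined:
  assumes "fe_subspace r W"
  obtains X where "finite X" "determined_by W X"
  using lagrange_determined[of r] assms by (metis determined_by_def fe_subspace_def subsetD)

text \<open>The difference of two candidates lies in \<open>W\<close> and is orthogonal to
  \<open>W\<close>, hence to itself. This is the tool for evaluating the definite description in
  \<open>L2_proj\<close>.\<close>

lemma L2_proj_unique:
  assumes W: "fe_subspace r W" and f: "f \<in> bounded_measurable a b"
    and w: "w \<in> W" "\<And>\<phi>. \<phi> \<in> W \<Longrightarrow> L2_inner a b w \<phi> = L2_inner a b f \<phi>"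
  shows "L2_proj a b W f = w"
  unfolding L2_proj_def
proof (rule the_equality)
  fix v assume v: "v \<in> W \<and> (\<forall>\<phi>\<in>W. L2_inner a b v \<phi> = L2_inner a b f \<phi>)"
  have sub: "g \<in> V r" "g \<in> bounded_measurable a b" if "g \<in> W" for g
    using W that fe_bounded_measurable by (auto simp: fe_subspace_def)
  define d where "d = (\<lambda>x. v x + (- 1) * w x)"
  have d: "d \<in> W" unfolding d_def
    using W v w by (intro fun_subspace_add_scaled) (auto simp: fe_subspace_def)
  have "L2_inner a b d d = L2_inner a b v d + (- 1) * L2_inner a b w d"
    unfolding d_def using d v w by (intro L2_inner_add_scaled sub) (auto simp: d_def)
  also have "\<dots> = 0" using v w d by simp
  finally have "d = (\<lambda>_. 0)" using L2_inner_definite sub d by blast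
  then have "d x = 0" for x by simp
  then have "v x = w x" for x by (simp add: d_def)
  then show "v = w" by blast
qed (use w in auto)

text \<open>The projection is the Riesz representer on \<open>W\<close> of the functional that pairs
  with \<open>f\<close>.\<close>

lemma L2_proj_exists:
  assumes W: "fe_subspace r W" and f: "f \<in> bounded_measurable a b"
  shows "\<exists>w\<in>W. \<forall>\<phi>\<in>W. L2_inner a b w \<phi> = L2_inner a b f \<phi>"
proof -
  have sub: "g \<in> V r" "g \<in> bounded_measurable a b" if "g \<in> W" for g
    using W that fe_bounded_measurable by (auto simp: fe_subspace_def)
  obtain X where "finite X" "determined_by W X" using fe_subspace_determined[OF W] .
  then show ?thesis using W f
    by (intro riesz_representation[of X])
      (auto simp: fe_subspace_def sub L2_inner_add_scaled L2_inner_add_scaled_right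
        intro: L2_inner_sym L2_inner_definite[OF sub(1)])
qed

lemma
  assumes "fe_subspace r W" "f \<in> bounded_measurable a b"
  shows L2_proj_in: "L2_proj a b W f \<in> W"
    and L2_proj_inner: "\<phi> \<in> W \<Longrightarrow> L2_inner a b (L2_proj a b W f) \<phi> = L2_inner a b f \<phi>"
proof -
  obtain w where w: "w \<in> W" "\<And>\<phi>. \<phi> \<in> W \<Longrightarrow> L2_inner a b w \<phi> = L2_inner a b f \<phi>"
    using L2_proj_exists[OF assms] by blast
  have "L2_proj a b W f = w" by (rule L2_proj_unique[OF assms w])
  then show "L2_proj a b W f \<in> W"
    and "\<phi> \<in> W \<Longrightarrow> L2_inner a b (L2_proj a b W f) \<phi> = L2_inner a b f \<phi>"
    using w by auto
qed

lemma L2_proj_sum: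
  assumes W: "fe_subspace r W" and g: "\<And>y. y \<in> Y \<Longrightarrow> g y \<in> bounded_measurable a b"
  shows "L2_proj a b W (\<lambda>x. \<Sum>y\<in>Y. c y * g y x) = (\<lambda>x. \<Sum>y\<in>Y. c y * L2_proj a b W (g y) x)"
proof (rule L2_proj_unique[OF W])
  have sub: "g \<in> bounded_measurable a b" if "g \<in> W" for g
    using W that fe_bounded_measurable by (auto simp: fe_subspace_def)
  show "(\<lambda>x. \<Sum>y\<in>Y. c y * g y x) \<in> bounded_measurable a b"
    using g by (intro bounded_measurable_sum bounded_measurable_scale)
  show "(\<lambda>x. \<Sum>y\<in>Y. c y * L2_proj a b W (g y) x) \<in> W"
    using W g L2_proj_in[OF W] by (intro fun_subspace_sum) (auto simp: fe_subspace_def)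
  fix \<phi> assume "\<phi> \<in> W"
  then show "L2_inner a b (\<lambda>x. \<Sum>y\<in>Y. c y * L2_proj a b W (g y) x) \<phi>
      = L2_inner a b (\<lambda>x. \<Sum>y\<in>Y. c y * g y x) \<phi>"
    using g by (simp add: L2_inner_sum sub L2_proj_in[OF W] L2_proj_inner[OF W])
qed

section \<open>Curves of finite element functions in time\<close>

text \<open>The functions \<open>e y\<close> do not depend on time, and the coefficients are point
  values of the curve, whose time regularity is what \<open>C1_curve\<close> provides.\<close>

lemma C1_curve_expansion:
  assumes "fe_subspace r W" "C1_curve T W f"
  obtains Y e where "finite Y" "\<And>y. y \<in> Y \<Longrightarrow> e y \<in> W"
    "\<And>s. s \<in> {0..T} \<Longrightarrow> f s = (\<lambda>x. \<Sum>y\<in>Y. f s y * e y x)"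
proof -
  obtain X where "finite X" "determined_by W X" using fe_subspace_determined[OF assms(1)] .
  then obtain Y e where "finite Y" "\<forall>y\<in>Y. e y \<in> W" "\<forall>f\<in>W. f = (\<lambda>x. \<Sum>y\<in>Y. f y * e y x)"
    using pointwise_basis_exists[of X W] assms(1) unfolding fe_subspace_def by blast
  then show ?thesis using assms(2) by (intro that[of Y e]) (auto simp: C1_curve_def)
qed

lemma C1_curve_deriv:
  assumes "C1_curve T W f" "t \<in> {0..T}"
  shows "((\<lambda>s. f s x) has_real_derivative t_deriv T f t x) (at t within {0..T})"
proof -
  have "(\<lambda>s. f s x) differentiable (at t within {0..T})"
    using assms by (simp add: C1_curve_def differentiable_on_def)
  then show ?thesis
    unfolding t_deriv_def has_real_derivative_iff_has_vector_derivative
    by (simp only: vector_derivative_works)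
qed

text \<open>The curve \<open>F\<close> may differ from \<open>f\<close>, as long as it has the same
  coefficients: with \<open>h\<close> the basis it gives the derivative of \<open>f\<close> itself,
  with \<open>h\<close> the image of the basis under a linear map that of the image curve. As
  \<open>T > 0\<close>, the derivative within the closed interval is unique, also at its
  ends.\<close>

lemma t_deriv_of_expansion:
  assumes f: "C1_curve T W f" and t: "t \<in> {0..T}" and T: "T > 0"
    and F: "\<And>s. s \<in> {0..T} \<Longrightarrow> F s = (\<lambda>x. \<Sum>y\<in>Y. f s y * h y x)"
  shows "t_deriv T F t = (\<lambda>x. \<Sum>y\<in>Y. t_deriv T f t y * h y x)"
proof
  fix x
  have "((\<lambda>s. \<Sum>y\<in>Y. f s y * h y x) has_real_derivative (\<Sum>y\<in>Y. t_deriv T f t y * h y x))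
      (at t within {0..T})"
    by (intro DERIV_sum DERIV_cmult_right C1_curve_deriv[OF f t])
  then have "((\<lambda>s. F s x) has_vector_derivative (\<Sum>y\<in>Y. t_deriv T f t y * h y x))
      (at t within {0..T})"
    unfolding has_real_derivative_iff_has_vector_derivative
    by (rule has_vector_derivative_transform[rotated 2]) (use t F in auto)
  from vector_derivative_within_closed_interval[OF T t this]
  show "t_deriv T F t x = (\<Sum>y\<in>Y. t_deriv T f t y * h y x)"
    by (simp only: t_deriv_def)
qed

text \<open>Differentiating the expansion leaves a combination of the same functions of
  \<open>W\<close>. The time derivatives of the solution can therefore serve as test
  functions.\<close>

lemma t_deriv_in:
  assumes W: "fe_subspace r W" and f: "C1_curve T W f" and t: "t \<in> {0..T}" "T > 0"
  shows "t_deriv T f t \<in> W"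
proof -
  obtain Y e where e: "\<And>y. y \<in> Y \<Longrightarrow> e y \<in> W"
    and rep: "\<And>s. s \<in> {0..T} \<Longrightarrow> f s = (\<lambda>x. \<Sum>y\<in>Y. f s y * e y x)"
    using C1_curve_expansion[OF W f] by metis
  have "(\<lambda>x. \<Sum>y\<in>Y. t_deriv T f t y * e y x) \<in> W"
    using W e by (intro fun_subspace_sum) (auto simp: fe_subspace_def)
  then show ?thesis using t_deriv_of_expansion[OF f t rep] by simp
qed

text \<open>Weak differentiation followed by projection is linear and independent of time, so it may
  be applied to the basis functions while the coefficients are differentiated.\<close>

lemma t_deriv_proj_x_deriv:
  assumes W: "fe_subspace r W" and U: "fe_subspace r U"
    and f: "C1_curve T W f" and t: "t \<in> {0..T}" "T > 0"
  shows "t_deriv T (\<lambda>s. L2_proj a b U (x_deriv a b N (f s))) t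
    = L2_proj a b U (x_deriv a b N (t_deriv T f t))"
proof -
  obtain Y e where e: "\<And>y. y \<in> Y \<Longrightarrow> e y \<in> V r"
    and rep: "\<And>s. s \<in> {0..T} \<Longrightarrow> f s = (\<lambda>x. \<Sum>y\<in>Y. f s y * e y x)"
    using C1_curve_expansion[OF W f] W unfolding fe_subspace_def by (metis subsetD)
  let ?P = "\<lambda>g. L2_proj a b U (x_deriv a b N g)"
  have lin: "?P (\<lambda>x. \<Sum>y\<in>Y. c y * e y x) = (\<lambda>x. \<Sum>y\<in>Y. c y * ?P (e y) x)" for c
  proof -
    have "x_deriv a b N (\<lambda>x. \<Sum>y\<in>Y. c y * e y x) = (\<lambda>x. \<Sum>y\<in>Y. c y * x_deriv a b N (e y) x)"
      by (rule x_deriv_sum[OF e])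
    then show ?thesis
      using L2_proj_sum[OF U x_deriv_bounded_measurable[OF e], of Y "\<lambda>y. y" c] by simp
  qed
  have "?P (f s) = (\<lambda>x. \<Sum>y\<in>Y. f s y * ?P (e y) x)" if "s \<in> {0..T}" for s
    using lin[of "f s"] rep[OF that] by simp
  then have "t_deriv T (\<lambda>s. ?P (f s)) t = (\<lambda>x. \<Sum>y\<in>Y. t_deriv T f t y * ?P (e y) x)"
    by (rule t_deriv_of_expansion[OF f t])
  also have "\<dots> = ?P (t_deriv T f t)"
    using lin[of "t_deriv T f t"] t_deriv_of_expansion[OF f t rep] by simp
  finally show ?thesis .
qed

text \<open>Joint continuity follows from the expansion, a finite sum of products of a function of
  time and a function of space. The Leibniz rule and the energy integrand rely on it.\<close>

lemma
  assumes W: "fe_subspace r W" and f: "C1_curve T W f" and T: "T > 0"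
  shows curve_continuous: "continuous_on ({0..T} \<times> {a..b}) (\<lambda>z. f (fst z) (snd z))"
    and curve_t_deriv_continuous:
      "continuous_on ({0..T} \<times> {a..b}) (\<lambda>z. t_deriv T f (fst z) (snd z))"
proof -
  obtain Y e where e: "\<And>y. y \<in> Y \<Longrightarrow> e y \<in> W"
    and rep: "\<And>s. s \<in> {0..T} \<Longrightarrow> f s = (\<lambda>x. \<Sum>y\<in>Y. f s y * e y x)"
    using C1_curve_expansion[OF W f] by metis
  have c: "continuous_on ({0..T} \<times> {a..b}) (\<lambda>z. \<Sum>y\<in>Y. c (fst z) y * e y (snd z))"
    if "\<And>y. continuous_on {0..T} (\<lambda>s. c s y)" for c
  proof -
    have "continuous_on ({0..T} \<times> {a..b}) (\<lambda>z. e y (snd z))" if "y \<in> Y" for y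
      using e[OF that] W
      by (intro continuous_on_compose2[OF fe_continuous[of "e y" r]]) (auto simp: fe_subspace_def intro!: continuous_intros)
    moreover have "continuous_on ({0..T} \<times> {a..b}) (\<lambda>z. c (fst z) y)" for y
      by (intro continuous_on_compose2[OF that]) (auto intro!: continuous_intros)
    ultimately show ?thesis by (intro continuous_intros)
  qed
  have "continuous_on {0..T} (\<lambda>s. f s y)" for y
    using f by (auto simp: C1_curve_def intro: differentiable_imp_continuous_on)
  from c[of f, OF this] show "continuous_on ({0..T} \<times> {a..b}) (\<lambda>z. f (fst z) (snd z))"
    by (rule continuous_on_eq) (metis rep mem_Times_iff)
  have "continuous_on {0..T} (\<lambda>s. t_deriv T f s y)" for y
    using f by (auto simp: C1_curve_def)
  from c[of "t_deriv T f", OF this]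
  show "continuous_on ({0..T} \<times> {a..b}) (\<lambda>z. t_deriv T f (fst z) (snd z))"
    by (rule continuous_on_eq) (metis t_deriv_of_expansion[OF f _ T rep] mem_Times_iff)
qed

section \<open>Time derivatives of mass and energy\<close>

text \<open>The Leibniz rule for the gauge integral, transferred to the Lebesgue integral both
  before and after differentiation.\<close>

lemma deriv_under_integral:
  assumes "\<And>s x. s \<in> {0..T} \<Longrightarrow> x \<in> {a..b} \<Longrightarrow>
      ((\<lambda>s. F s x) has_real_derivative F' s x) (at s within {0..T})"
    and F: "\<And>s. s \<in> {0..T} \<Longrightarrow> F s \<in> bounded_measurable a b"
    and c: "continuous_on ({0..T} \<times> {a..b}) (\<lambda>z. F' (fst z) (snd z))"
    and t: "t \<in> {0..T}"
  shows "((\<lambda>s. \<integral>x. F s x \<partial>lebesgue_on {a..b}) has_real_derivative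
      (\<integral>x. F' t x \<partial>lebesgue_on {a..b})) (at t within {0..T})"
proof -
  have "((\<lambda>s. integral (cbox a b) (F s)) has_real_derivative integral (cbox a b) (F' t))
      (at t within {0..T})"
    using assms by (intro leibniz_rule_field_derivative)
      (auto simp: case_prod_unfold intro: bounded_measurable_integrable_on)
  then have D: "((\<lambda>s. integral {a..b} (F s)) has_real_derivative integral {a..b} (F' t))
      (at t within {0..T})" by simp
  have "continuous_on {a..b} (\<lambda>x. (t, x))" by (intro continuous_intros)
  then have "continuous_on {a..b} (\<lambda>x. F' (fst (t, x)) (snd (t, x)))"
    by (rule continuous_on_compose2[OF c]) (use t in auto)
  then have "continuous_on {a..b} (F' t)" by simp
  then have "(\<integral>x. F' t x \<partial>lebesgue_on {a..b}) = integral {a..b} (F' t)"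
    by (intro bounded_measurable_integral continuous_bounded_measurable)
  then show ?thesis
    using has_vector_derivative_transform[OF t bounded_measurable_integral[OF F]] D
    unfolding has_real_derivative_iff_has_vector_derivative by simp
qed

lemma mass_deriv:
  assumes \<eta>: "C1_curve T (V r) \<eta>" and t: "t \<in> {0..T}" "T > 0"
  shows "(mass a b \<eta> has_real_derivative L2_inner a b (t_deriv T \<eta> t) (\<lambda>_. 1)) (at t within {0..T})"
proof -
  have "mass a b \<eta> = (\<lambda>s. \<integral>x. \<eta> s x \<partial>lebesgue_on {a..b})" by (simp add: mass_def fun_eq_iff)
  moreover have "\<eta> s \<in> bounded_measurable a b" if "s \<in> {0..T}" for s
    using \<eta> that by (auto simp: C1_curve_def intro: fe_bounded_measurable)
  ultimately show ?thesis
    using deriv_under_integral[of T \<eta> "t_deriv T \<eta>" t]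
      C1_curve_deriv[OF \<eta>] curve_t_deriv_continuous[OF fe_subspace_lagrange \<eta> t(2)] t
    by (simp add: L2_inner_def)
qed

text \<open>The chain rule, grouped by time derivative: the functions paired with \<eta>_t and u_t
  are the variational derivatives of the energy with respect to \<eta> and u.\<close>

lemma energy_deriv:
  assumes \<eta>: "C1_curve T (V r) \<eta>" and u: "C1_curve T (V0 r) u" and t: "t \<in> {0..T}" "T > 0"
  shows "(energy a b \<eta> u has_real_derivative
      L2_inner a b (t_deriv T \<eta> t) (\<lambda>x. \<eta> t x + 1/2 * (u t x)\<^sup>2)
      + L2_inner a b (t_deriv T u t) (\<lambda>x. (1 + \<eta> t x) * u t x)) (at t within {0..T})"
proof -
  let ?F = "\<lambda>s x. (\<eta> s x)\<^sup>2 + (1 + \<eta> s x) * (u s x)\<^sup>2"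
  \<comment> \<open>The factor 2 is taken out to cancel the factor 1/2 in the energy.\<close>
  define F' where "F' = (\<lambda>s x. 2 * (t_deriv T \<eta> s x * (\<eta> s x + 1/2 * (u s x)\<^sup>2)
    + t_deriv T u s x * ((1 + \<eta> s x) * u s x)))"
  have mem: "\<eta> s \<in> V r" "u s \<in> V r" if "s \<in> {0..T}" for s
    using \<eta> u that lagrange0_subset[of r] by (auto simp: C1_curve_def)
  have "((\<lambda>s. \<integral>x. ?F s x \<partial>lebesgue_on {a..b}) has_real_derivative
      (\<integral>x. F' t x \<partial>lebesgue_on {a..b})) (at t within {0..T})"
  proof (rule deriv_under_integral)
    show "?F s \<in> bounded_measurable a b" if "s \<in> {0..T}" for s
      using mem[OF that] by (intro continuous_bounded_measurable continuous_intros fe_continuous)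
    show "continuous_on ({0..T} \<times> {a..b}) (\<lambda>z. F' (fst z) (snd z))"
      unfolding F'_def
      by (intro continuous_intros curve_continuous[OF fe_subspace_lagrange \<eta> t(2)]
          curve_continuous[OF fe_subspace_lagrange0 u t(2)]
          curve_t_deriv_continuous[OF fe_subspace_lagrange \<eta> t(2)]
          curve_t_deriv_continuous[OF fe_subspace_lagrange0 u t(2)])
    show "((\<lambda>s. ?F s x) has_real_derivative F' s x) (at s within {0..T})" if "s \<in> {0..T}" for s x
      using C1_curve_deriv[OF \<eta> that, of x] C1_curve_deriv[OF u that, of x]
      by (auto intro!: derivative_eq_intros simp: F'_def algebra_simps power2_eq_square)
  qed (use t in auto)
  from DERIV_cmult[OF this, of "1/2"]
  have "(energy a b \<eta> u has_real_derivative 1/2 * (\<integral>x. F' t x \<partial>lebesgue_on {a..b})) (at t within {0..T})"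
    unfolding energy_def by simp
  moreover have "(\<integral>x. F' t x \<partial>lebesgue_on {a..b}) = 2 *
      (L2_inner a b (t_deriv T \<eta> t) (\<lambda>x. \<eta> t x + 1/2 * (u t x)\<^sup>2)
      + L2_inner a b (t_deriv T u t) (\<lambda>x. (1 + \<eta> t x) * u t x))"
  proof -
    have "t_deriv T \<eta> t \<in> V r" "t_deriv T u t \<in> V r"
      using t_deriv_in[OF fe_subspace_lagrange \<eta> t] t_deriv_in[OF fe_subspace_lagrange0 u t]
        lagrange0_subset[of r] by auto
    note cont = this[THEN fe_continuous] mem[OF t(1), THEN fe_continuous]
    have "integrable (lebesgue_on {a..b}) (\<lambda>x. t_deriv T \<eta> t x * (\<eta> t x + 1/2 * (u t x)\<^sup>2))"
      "integrable (lebesgue_on {a..b}) (\<lambda>x. t_deriv T u t x * ((1 + \<eta> t x) * u t x))"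
      by (intro bounded_measurable_integrable continuous_bounded_measurable continuous_intros cont)+
    from Bochner_Integration.integral_add[OF this] show ?thesis
      by (simp only: F'_def L2_inner_def integral_mult_right_zero)
  qed
  ultimately show ?thesis by (simp add: add_divide_distrib)
qed

end

section \<open>Conservation laws of the semidiscrete system\<close>

theorem proposition2p1:
  fixes a b T :: real and N r :: nat
    and \<eta>0 u0 :: "real \<Rightarrow> real" and \<eta> u :: "real \<Rightarrow> real \<Rightarrow> real"
  assumes "a < b" and "N \<ge> 1" and "r \<ge> 1" and "T > 0"
    and "\<eta>0 \<in> L2_space a b" and "u0 \<in> L2_space a b"
    and "C1_curve T (lagrange_space a b N r) \<eta>"
    and "C1_curve T (lagrange_space0 a b N r) u"
    and "\<And>t \<phi>. t \<in> {0..T} \<Longrightarrow> \<phi> \<in> lagrange_space a b N r \<Longrightarrow>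
      L2_inner a b (t_deriv T \<eta> t) \<phi>
      + 1/6 * L2_inner a b
          (t_deriv T (\<lambda>s. L2_proj a b (lagrange_space0 a b N r) (x_deriv a b N (\<eta> s))) t)
          (x_deriv a b N \<phi>)
      = L2_inner a b
          (L2_proj a b (lagrange_space0 a b N r) (\<lambda>x. (1 + \<eta> t x) * u t x))
          (x_deriv a b N \<phi>)"
    and "\<And>t \<psi>. t \<in> {0..T} \<Longrightarrow> \<psi> \<in> lagrange_space0 a b N r \<Longrightarrow>
      L2_inner a b (t_deriv T u t) \<psi>
      + 1/6 * L2_inner a b
          (t_deriv T (\<lambda>s. L2_proj a b (lagrange_space a b N r) (x_deriv a b N (u s))) t)
          (x_deriv a b N \<psi>)
      = 1/2 * L2_inner a b
          (L2_proj a b (lagrange_space a b N r) (\<lambda>x. (u t x)\<^sup>2))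
          (x_deriv a b N \<psi>)
      + L2_inner a b
          (L2_proj a b (lagrange_space a b N r) (\<eta> t))
          (x_deriv a b N \<psi>)"
    and "\<eta> 0 = L2_proj a b (lagrange_space a b N r) \<eta>0"
    and "u 0 = L2_proj a b (lagrange_space0 a b N r) u0"
  shows "\<forall>t\<in>{0..T}.
      (mass a b \<eta> has_real_derivative 0) (at t within {0..T})
    \<and> (energy a b \<eta> u has_real_derivative 0) (at t within {0..T})"
proof (intro ballI conjI)
  fix t assume t: "t \<in> {0..T}"
  interpret uniform_mesh a b N using assms(1,2) by unfold_locales
  note T = assms(4) and C\<eta> = assms(7) and Cu = assms(8)
  note SV = fe_subspace_lagrange[of r] and SV0 = fe_subspace_lagrange0[of r]
  let ?I = "L2_inner a b" and ?D = "x_deriv a b N"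
  let ?P = "L2_proj a b (V r)" and ?R = "L2_proj a b (V0 r)"
  define \<eta>' u' where "\<eta>' = t_deriv T \<eta> t" and "u' = t_deriv T u t"
  have \<eta>': "\<eta>' \<in> V r" and u': "u' \<in> V0 r"
    unfolding \<eta>'_def u'_def using t_deriv_in[OF SV C\<eta> t T] t_deriv_in[OF SV0 Cu t T] .
  have \<eta>: "\<eta> t \<in> V r" and u: "u t \<in> V0 r" using C\<eta> Cu t by (auto simp: C1_curve_def)
  have V0V: "f \<in> V r" if "f \<in> V0 r" for f using that lagrange0_subset by blast
  note bm = fe_bounded_measurable[of _ r] and bmD = x_deriv_bounded_measurable[of _ r]

  \<comment> \<open>These are the time derivatives occurring in the system, after commuting them
    with projection and weak derivative. \<open>A\<close> lies in \<open>V r\<close> and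
    \<open>B\<close> in \<open>V0 r\<close>, so each is an admissible test function,
    \<open>A\<close> in the first equation and \<open>B\<close> in the second.\<close>
  define A B where "A = ?P (?D u')" and "B = ?R (?D \<eta>')"
  have A: "A \<in> V r" "\<And>f. f \<in> V r \<Longrightarrow> ?I A f = ?I (?D u') f"
    unfolding A_def using L2_proj_in[OF SV] L2_proj_inner[OF SV] bmD[OF V0V[OF u']] by auto
  have B: "B \<in> V0 r" "\<And>f. f \<in> V0 r \<Longrightarrow> ?I B f = ?I (?D \<eta>') f"
    unfolding B_def using L2_proj_in[OF SV0] L2_proj_inner[OF SV0] bmD[OF \<eta>'] by auto

  \<comment> \<open>The variational derivatives of the energy need not lie in the finite element
    spaces. \<open>F\<close> and \<open>G\<close> are their projections, which can be used as test
    functions; in \<open>F\<close> only the quadratic term has to be projected.\<close>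
  define Q where "Q = ?P (\<lambda>x. (u t x)\<^sup>2)"
  define F where "F = (\<lambda>x. \<eta> t x + 1/2 * Q x)"
  define G where "G = ?R (\<lambda>x. (1 + \<eta> t x) * u t x)"
  have cu: "continuous_on {a..b} (\<lambda>x. (u t x)\<^sup>2)"
      "continuous_on {a..b} (\<lambda>x. (1 + \<eta> t x) * u t x)"
    by (intro continuous_intros fe_continuous[OF \<eta>] fe_continuous[OF V0V[OF u]])+
  note bmu = continuous_bounded_measurable[OF cu(1)] continuous_bounded_measurable[OF cu(2)]
  have Q: "Q \<in> V r" "\<And>f. f \<in> V r \<Longrightarrow> ?I Q f = ?I (\<lambda>x. (u t x)\<^sup>2) f"
    unfolding Q_def using L2_proj_in[OF SV bmu(1)] L2_proj_inner[OF SV bmu(1)] by auto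
  have G: "G \<in> V0 r" "\<And>f. f \<in> V0 r \<Longrightarrow> ?I G f = ?I (\<lambda>x. (1 + \<eta> t x) * u t x) f"
    unfolding G_def using L2_proj_in[OF SV0 bmu(2)] L2_proj_inner[OF SV0 bmu(2)] by auto
  have F: "F \<in> V r" unfolding F_def using \<eta> Q by (intro fun_subspace_add_scaled fun_subspace_lagrange)
  have P\<eta>: "?P (\<eta> t) = \<eta> t" by (rule L2_proj_unique[OF SV bm]) (use \<eta> in auto)

  define W where "W = (\<lambda>x. G x + (- (1/6)) * B x)"
  define Z where "Z = (\<lambda>x. F x + (- (1/6)) * A x)"
  have W: "W \<in> V0 r" unfolding W_def using G B by (intro fun_subspace_add_scaled fun_subspace_lagrange0)
  have Z: "Z \<in> V r" unfolding Z_def using F A by (intro fun_subspace_add_scaled fun_subspace_lagrange)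
  have FZ: "F = (\<lambda>x. Z x + 1/6 * A x)" and GW: "G = (\<lambda>x. W x + 1/6 * B x)"
    by (simp_all add: Z_def W_def)

  have eq1: "?I \<eta>' \<phi> = ?I W (?D \<phi>)" if \<phi>: "\<phi> \<in> V r" for \<phi>
  proof -
    have "?I \<eta>' \<phi> + 1/6 * ?I B (?D \<phi>) = ?I G (?D \<phi>)"
      using assms(9)[OF t \<phi>] t_deriv_proj_x_deriv[OF SV SV0 C\<eta> t T]
      by (simp add: \<eta>'_def B_def G_def)
    then show ?thesis
      unfolding W_def using L2_inner_add_scaled[OF bm bm bmD, of G B \<phi> "- (1/6)"] G B V0V \<phi> by simp
  qed
  have eq2: "?I u' \<psi> = ?I Z (?D \<psi>)" if \<psi>: "\<psi> \<in> V0 r" for \<psi>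
  proof -
    have "?I u' \<psi> + 1/6 * ?I A (?D \<psi>) = 1/2 * ?I Q (?D \<psi>) + ?I (\<eta> t) (?D \<psi>)"
      using assms(10)[OF t \<psi>] t_deriv_proj_x_deriv[OF SV0 SV Cu t T] P\<eta>
      by (simp add: u'_def A_def Q_def)
    moreover have "?I F (?D \<psi>) = ?I (\<eta> t) (?D \<psi>) + 1/2 * ?I Q (?D \<psi>)"
      unfolding F_def by (rule L2_inner_add_scaled[OF bm bm bmD]) (use \<eta> Q \<psi> V0V in auto)
    ultimately show ?thesis
      unfolding Z_def using L2_inner_add_scaled[OF bm bm bmD, of F A \<psi> "- (1/6)"] F A V0V \<psi> by simp
  qed

  \<comment> \<open>The constant 1 in its extension by zero, since members of \<open>V r\<close>
    vanish outside the interval.\<close>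
  define one :: "real \<Rightarrow> real" where "one = indicator {a..b}"
  have one: "one \<in> V r"
  proof -
    have "\<exists>p. degree p \<le> r \<and> (\<forall>x\<in>{node a b N j..node a b N (Suc j)}. one x = poly p x)"
      if "j < N" for j
      using element_subset[OF that] by (intro exI[of _ 1]) (auto simp: one_def indicator_def)
    moreover have "continuous_on {a..b} one"
      by (rule continuous_on_eq[of _ "\<lambda>_. 1"]) (auto simp: one_def)
    ultimately show ?thesis by (auto simp: lagrange_space_def one_def)
  qed
  have "?I \<eta>' (\<lambda>_. 1) = ?I \<eta>' one"
    unfolding L2_inner_def by (intro Bochner_Integration.integral_cong) (auto simp: one_def)
  also have "\<dots> = ?I W (?D one)" by (rule eq1[OF one])
  also have "?D one = (\<lambda>_. 0)"
  proof
    fix x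
    show "?D one x = 0"
    proof (cases "x \<in> {a..b} - nodes")
      case True
      then obtain j where j: "j < N" "node a b N j < x" "x < node a b N (Suc j)"
        using open_elements_cover by blast
      have "(one has_real_derivative poly (pderiv 1) x) (at x)"
        using j element_subset[OF j(1)]
        by (intro poly_piece_deriv[of "node a b N j" "node a b N (Suc j)"])
          (auto simp: one_def indicator_def)
      then show ?thesis using DERIV_unique[OF fe_deriv[OF one True]] by simp
    qed (rule x_deriv_eq_0)
  qed
  also have "?I W (\<lambda>_. 0) = 0" by (simp add: L2_inner_def)
  finally show "(mass a b \<eta> has_real_derivative 0) (at t within {0..T})"
    using mass_deriv[OF C\<eta> t T] by (simp add: \<eta>'_def)

  \<comment> \<open>As \<open>\<eta>'\<close> lies in \<open>V r\<close> and \<open>u'\<close> in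
    \<open>V0 r\<close>, pairing with them does not distinguish the variational derivatives from
    their projections.\<close>
  have "?I \<eta>' F = ?I \<eta>' (\<lambda>x. \<eta> t x + 1/2 * (u t x)\<^sup>2)"
    unfolding F_def using \<eta> \<eta>' Q bmu(1)
    by (simp only: L2_inner_add_scaled_right bm) (simp add: L2_inner_sym[of a b \<eta>'])
  moreover have "?I u' G = ?I u' (\<lambda>x. (1 + \<eta> t x) * u t x)"
    using G(2)[OF u'] by (simp add: L2_inner_sym)
  ultimately have D: "(energy a b \<eta> u has_real_derivative (?I \<eta>' F + ?I u' G)) (at t within {0..T})"
    using energy_deriv[OF C\<eta> Cu t T] by (simp add: \<eta>'_def u'_def)
  have DF: "?D F = (\<lambda>x. ?D Z x + 1/6 * ?D A x)"
    unfolding FZ by (rule x_deriv_add_scaled[OF Z A(1)])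
  have DG: "?D G = (\<lambda>x. ?D W x + 1/6 * ?D B x)"
    unfolding GW by (rule x_deriv_add_scaled[OF V0V[OF W] V0V[OF B(1)]])
  have "?I \<eta>' F = ?I W (?D Z) + 1/6 * ?I W (?D A)"
    unfolding eq1[OF F] DF by (rule L2_inner_add_scaled_right[OF bmD bmD bm]) (use Z A W V0V in auto)
  \<comment> \<open>The first equation tested with \<open>A\<close> turns the left side into the
    pairing of \<open>\<eta>'\<close> with \<open>A\<close>; the projection in \<open>A\<close> then
    disappears because \<open>\<eta>'\<close> lies in \<open>V r\<close>. The term with
    \<open>B\<close> below is treated in the same way through the second equation.\<close>
  moreover have "?I W (?D A) = ?I (?D u') \<eta>'"
    using eq1[OF A(1)] A(2)[OF \<eta>'] by (simp add: L2_inner_sym)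
  moreover have "?I u' G = ?I Z (?D W) + 1/6 * ?I Z (?D B)"
    unfolding eq2[OF G(1)] DG by (rule L2_inner_add_scaled_right[OF bmD bmD bm]) (use Z B W V0V in auto)
  moreover have "?I Z (?D B) = ?I (?D \<eta>') u'"
    using eq2[OF B(1)] B(2)[OF u'] by (simp add: L2_inner_sym)
  \<comment> \<open>The terms left are the boundary-free pair for \<open>Z\<close> and
    \<open>W\<close>, and 1/6 of the one for \<open>\<eta>'\<close> and \<open>u'\<close>.\<close>
  ultimately have "?I \<eta>' F + ?I u' G = 0"
    using integration_by_parts_0[OF Z W] integration_by_parts_0[OF \<eta>' u']
    by (simp add: L2_inner_sym)
  with D show "(energy a b \<eta> u has_real_derivative 0) (at t within {0..T})" by simp
qed

end
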